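(* Let $a$ and $b>0$ be continuous real functions with $b^2$ locally Lipschitz, let $B=(B_t)_{t\ge 0}$ be a standard Brownian motion, and let $Z=(Z_t)_{t\ge0}$ be a one-dimensional diffusion process starting at $0$ and solving $dZ_t=a(Z_t)\,dt+b(Z_t)\,dB_t$. Let $\ell$ be a real-valued random variable independent of $Z$ with distribution function $F$, let $\tau_\ell=\inf\{t\ge0 \mid Z_t=\ell\}$, and let $c>0$ be a constant. Set $I^Z_t=\inf_{0\le s\le t}Z_s$ and $S^Z_t=\sup_{0\le s\le t}Z_s$ for $t\ge0$. Then the quickest detection problem $$V_1=\inf_\tau\bigl[\mathsf P(\tau<\tau_\ell)+c\,\mathsf E(\tau-\tau_\ell)^+\bigr]$$ is equivalent to the optimal stopping problem $$V_2=\sup_\tau \mathsf E\Bigl[F(S^Z_\tau)-F(I^Z_\tau-)-c\int_0^\tau\bigl[F(S^Z_t)-F(I^Z_t-)\bigr]\,dt\Bigr],$$ where in both problems $\tau$ ranges over all stopping times of $Z$. Here equivalent means that $V_1=1-V_2$ and that a stopping time $\tau$ of $Z$ is optimal in the first problem (attains the infimum) if and only if it is optimal in the second problem (attains the supremum).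
   Context: A stopping time of $Z$ means a finite-valued stopping time with respect to the natural filtration $(\mathcal F^Z_t)_{t\ge0}$ generated by $Z$. The symbol $F(y-)$ denotes the left limit of $F$ at $y$, and $x^+=\max(x,0)$. The first entry time $\tau_\ell$ is $+\infty$ if $Z$ never hits $\ell$. *)

theory Defs
  imports "HOL-Probability.Probability"
begin

text \<open>
  Time is of type \<open>real\<close>; only the values of a process at times \<open>\<ge> 0\<close> are ever used.
\<close>

definition gen_sigma :: "'w measure \<Rightarrow> (real \<Rightarrow> 'w \<Rightarrow> real) \<Rightarrow> real set \<Rightarrow> 'w measure" where
  "gen_sigma M X I = sigma (space M) {X s -` A \<inter> space M | s A. s \<in> I \<and> A \<in> sets borel}"

text \<open>For \<open>t < 0\<close> this is the trivial \<open>\<sigma>\<close>-algebra.\<close>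

definition natural_filtration ::
    "'w measure \<Rightarrow> (real \<Rightarrow> 'w \<Rightarrow> real) \<Rightarrow> real \<Rightarrow> 'w measure" where
  "natural_filtration M X t = gen_sigma M X {0..t}"

definition stopping_times_of ::
    "'w measure \<Rightarrow> (real \<Rightarrow> 'w \<Rightarrow> real) \<Rightarrow> ('w \<Rightarrow> real) set" where
  "stopping_times_of M X =
     {\<tau>. stopping_time (natural_filtration M X) \<tau> \<and> (\<forall>\<omega>\<in>space M. 0 \<le> \<tau> \<omega>)}"

definition adapted :: "(real \<Rightarrow> 'w measure) \<Rightarrow> (real \<Rightarrow> 'w \<Rightarrow> real) \<Rightarrow> bool" where
  "adapted G X \<longleftrightarrow> (\<forall>t\<ge>0. X t \<in> borel_measurable (G t))"

definition progressive :: "(real \<Rightarrow> 'w measure) \<Rightarrow> (real \<Rightarrow> 'w \<Rightarrow> real) \<Rightarrow> bool" where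
  "progressive G H \<longleftrightarrow>
     (\<forall>T\<ge>0. (\<lambda>(t, \<omega>). H t \<omega>) \<in> borel_measurable (restrict_space borel {0..T} \<Otimes>\<^sub>M G T))"

definition brownian_motion ::
    "'w measure \<Rightarrow> (real \<Rightarrow> 'w measure) \<Rightarrow> (real \<Rightarrow> 'w \<Rightarrow> real) \<Rightarrow> bool" where
  "brownian_motion M G B \<longleftrightarrow>
     adapted G B \<and>
     (AE \<omega> in M. B 0 \<omega> = 0) \<and>
     (AE \<omega> in M. continuous_on {0..} (\<lambda>t. B t \<omega>)) \<and>
     (\<forall>s t. 0 \<le> s \<and> s < t \<longrightarrow>
        distributed M lborel (\<lambda>\<omega>. B t \<omega> - B s \<omega>) (\<lambda>x. ennreal (normal_density 0 (sqrt (t - s)) x)) \<and>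
        prob_space.indep_set M (sets (G s))
          (sets (vimage_algebra (space M) (\<lambda>\<omega>. B t \<omega> - B s \<omega>) borel)))"

definition null_in_prob :: "'w measure \<Rightarrow> (nat \<Rightarrow> 'w \<Rightarrow> ennreal) \<Rightarrow> bool" where
  "null_in_prob M Y \<longleftrightarrow>
     (\<forall>k. Y k \<in> borel_measurable M) \<and>
     (\<forall>\<epsilon>>0. (\<lambda>k. emeasure M {\<omega> \<in> space M. \<epsilon> < Y k \<omega>}) \<longlonglongrightarrow> 0)"

text \<open>
  A triple \<open>(n, p, \<xi>)\<close> encodes the simple integrand with value \<open>\<xi> i\<close>
  on the time interval from \<open>p i\<close> (exclusive) to \<open>p (Suc i)\<close> (inclusive), for \<open>i < n\<close>.
\<close>

definition simple_integrand ::
    "'w measure \<Rightarrow> (real \<Rightarrow> 'w measure) \<Rightarrow> nat \<Rightarrow> (nat \<Rightarrow> real) \<Rightarrow> (nat \<Rightarrow> 'w \<Rightarrow> real) \<Rightarrow> bool" where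
  "simple_integrand M G n p \<xi> \<longleftrightarrow>
     0 \<le> p 0 \<and>
     (\<forall>i<n. p i < p (Suc i) \<and> \<xi> i \<in> borel_measurable (G (p i)) \<and>
            (\<exists>C. \<forall>\<omega>\<in>space M. \<bar>\<xi> i \<omega>\<bar> \<le> C))"

definition simple_val :: "nat \<Rightarrow> (nat \<Rightarrow> real) \<Rightarrow> (nat \<Rightarrow> 'w \<Rightarrow> real) \<Rightarrow> real \<Rightarrow> 'w \<Rightarrow> real" where
  "simple_val n p \<xi> t \<omega> = (\<Sum>i<n. \<xi> i \<omega> * indicator {p i<..p (Suc i)} t)"

definition simple_ito ::
    "(real \<Rightarrow> 'w \<Rightarrow> real) \<Rightarrow> nat \<Rightarrow> (nat \<Rightarrow> real) \<Rightarrow> (nat \<Rightarrow> 'w \<Rightarrow> real) \<Rightarrow> real \<Rightarrow> 'w \<Rightarrow> real" where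
  "simple_ito B n p \<xi> t \<omega> =
     (\<Sum>i<n. \<xi> i \<omega> * (B (min t (p (Suc i))) \<omega> - B (min t (p i)) \<omega>))"

text \<open>
  \<open>is_ito_integral M G B H J\<close>: the integrand \<open>H\<close> is progressive and almost surely locally
  square integrable in time, and \<open>J\<close> is (a version with almost surely continuous paths of) its
  Ito integral against \<open>B\<close>, that is, the limit in probability of the integrals of simple
  integrands approximating \<open>H\<close> in \<open>L\<^sup>2\<close> on compact time intervals, in probability.
  Convergence at each fixed time determines \<open>J\<close> up to indistinguishability,
  because its paths are continuous.
\<close>

definition is_ito_integral ::
    "'w measure \<Rightarrow> (real \<Rightarrow> 'w measure) \<Rightarrow> (real \<Rightarrow> 'w \<Rightarrow> real) \<Rightarrow>
     (real \<Rightarrow> 'w \<Rightarrow> real) \<Rightarrow> (real \<Rightarrow> 'w \<Rightarrow> real) \<Rightarrow> bool" where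
  "is_ito_integral M G B H J \<longleftrightarrow>
     progressive G H \<and>
     (\<forall>T\<ge>0. AE \<omega> in M. (\<integral>\<^sup>+t\<in>{0..T}. ennreal ((H t \<omega>)\<^sup>2) \<partial>lborel) < \<infinity>) \<and>
     (\<forall>t\<ge>0. J t \<in> borel_measurable M) \<and>
     (AE \<omega> in M. continuous_on {0..} (\<lambda>t. J t \<omega>)) \<and>
     (\<exists>n p \<xi>.
        (\<forall>k. simple_integrand M G (n k) (p k) (\<xi> k)) \<and>
        (\<forall>T\<ge>0.
           null_in_prob M (\<lambda>k \<omega>. \<integral>\<^sup>+t\<in>{0..T}.
             ennreal ((simple_val (n k) (p k) (\<xi> k) t \<omega> - H t \<omega>)\<^sup>2) \<partial>lborel) \<and>
           null_in_prob M (\<lambda>k \<omega>. ennreal \<bar>simple_ito B (n k) (p k) (\<xi> k) T \<omega> - J T \<omega>\<bar>)))"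

text \<open>
  All paths of \<open>Z\<close> are required to be continuous, so that its running extrema and its first
  entry times are measurable without completing the natural filtration.
\<close>

definition diffusion_solving ::
    "'w measure \<Rightarrow> (real \<Rightarrow> 'w measure) \<Rightarrow> (real \<Rightarrow> real) \<Rightarrow> (real \<Rightarrow> real) \<Rightarrow>
     (real \<Rightarrow> 'w \<Rightarrow> real) \<Rightarrow> (real \<Rightarrow> 'w \<Rightarrow> real) \<Rightarrow> bool" where
  "diffusion_solving M G a b B Z \<longleftrightarrow>
     adapted G Z \<and>
     (\<forall>\<omega>\<in>space M. continuous_on {0..} (\<lambda>t. Z t \<omega>)) \<and>
     (\<exists>J. is_ito_integral M G B (\<lambda>t \<omega>. b (Z t \<omega>)) J \<and>
        (AE \<omega> in M. \<forall>t\<ge>0. Z t \<omega> = Z 0 \<omega> + (LINT s:{0..t}|lborel. a (Z s \<omega>)) + J t \<omega>))"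

definition run_inf :: "(real \<Rightarrow> 'w \<Rightarrow> real) \<Rightarrow> real \<Rightarrow> 'w \<Rightarrow> real" where
  "run_inf Z t \<omega> = (INF s\<in>{0..t}. Z s \<omega>)"

definition run_sup :: "(real \<Rightarrow> 'w \<Rightarrow> real) \<Rightarrow> real \<Rightarrow> 'w \<Rightarrow> real" where
  "run_sup Z t \<omega> = (SUP s\<in>{0..t}. Z s \<omega>)"

definition entry_time :: "(real \<Rightarrow> 'w \<Rightarrow> real) \<Rightarrow> ('w \<Rightarrow> real) \<Rightarrow> 'w \<Rightarrow> ereal" where
  "entry_time Z l \<omega> = Inf {ereal t | t. 0 \<le> t \<and> Z t \<omega> = l \<omega>}"

definition left_limit :: "(real \<Rightarrow> real) \<Rightarrow> real \<Rightarrow> real" where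
  "left_limit F y = Lim (at_left y) F"

text \<open>
  Expectation with values in the extended reals. The Bochner integral would assign 0 to variables
  that are not integrable, whereas the delay and the cost may have infinite expectation. In both
  problems below at most one of the two parts is infinite.
\<close>

definition ext_expectation :: "'w measure \<Rightarrow> ('w \<Rightarrow> ereal) \<Rightarrow> ereal" where
  "ext_expectation M X =
     enn2ereal (\<integral>\<^sup>+\<omega>. e2ennreal (max 0 (X \<omega>)) \<partial>M) - enn2ereal (\<integral>\<^sup>+\<omega>. e2ennreal (max 0 (- X \<omega>)) \<partial>M)"

definition detection_risk ::
    "'w measure \<Rightarrow> (real \<Rightarrow> 'w \<Rightarrow> real) \<Rightarrow> ('w \<Rightarrow> real) \<Rightarrow> real \<Rightarrow> ('w \<Rightarrow> real) \<Rightarrow> ereal" where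
  "detection_risk M Z l c \<tau> =
     ereal (measure M {\<omega> \<in> space M. ereal (\<tau> \<omega>) < entry_time Z l \<omega>}) +
     ereal c * ext_expectation M (\<lambda>\<omega>. max (ereal (\<tau> \<omega>) - entry_time Z l \<omega>) 0)"

definition stopping_gain ::
    "'w measure \<Rightarrow> (real \<Rightarrow> 'w \<Rightarrow> real) \<Rightarrow> (real \<Rightarrow> real) \<Rightarrow> real \<Rightarrow> ('w \<Rightarrow> real) \<Rightarrow> ereal" where
  "stopping_gain M Z F c \<tau> =
     ext_expectation M (\<lambda>\<omega>. ereal (
       F (run_sup Z (\<tau> \<omega>) \<omega>) - left_limit F (run_inf Z (\<tau> \<omega>) \<omega>) -
       c * (LINT t:{0..\<tau> \<omega>}|lborel. F (run_sup Z t \<omega>) - left_limit F (run_inf Z t \<omega>))))"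

definition V1 ::
    "'w measure \<Rightarrow> (real \<Rightarrow> 'w \<Rightarrow> real) \<Rightarrow> ('w \<Rightarrow> real) \<Rightarrow> real \<Rightarrow> ereal" where
  "V1 M Z l c = (INF \<tau>\<in>stopping_times_of M Z. detection_risk M Z l c \<tau>)"

definition V2 ::
    "'w measure \<Rightarrow> (real \<Rightarrow> 'w \<Rightarrow> real) \<Rightarrow> (real \<Rightarrow> real) \<Rightarrow> real \<Rightarrow> ereal" where
  "V2 M Z F c = (SUP \<tau>\<in>stopping_times_of M Z. stopping_gain M Z F c \<tau>)"

end

theory Submission
  imports Defs
begin

text \<open>
  By continuity of the paths, \<open>\<tau>\<^sub>\<ell> \<le> t\<close> holds iff \<open>I\<^sub>t \<le> \<ell> \<le> S\<^sub>t\<close>, which given \<open>Z\<close> has probability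
  \<open>F(S\<^sub>t) - F(I\<^sub>t-)\<close> because \<open>\<ell>\<close> is independent of \<open>Z\<close>. Taking \<open>t = \<tau>\<close>, and integrating
  \<open>(\<tau> - \<tau>\<^sub>\<ell>)\<^sup>+ = \<integral>\<^sub>0\<^sup>\<tau> 1(\<tau>\<^sub>\<ell> \<le> t) dt\<close> with Tonelli's theorem, the risk of each stopping time
  \<open>\<tau>\<close> is one minus its gain. Measurability of both integrands comes from the joint measurability of
  the first entry time in the path and the level.
\<close>

section \<open>First entry times and running extrema of a continuous path\<close>

lemma entry_time_nonneg: "0 \<le> entry_time Z l \<omega>"
  unfolding entry_time_def by (rule Inf_greatest) (auto simp: zero_ereal_def)

text \<open>The times at which a continuous path is at a given level form a closed set bounded
  below, so a finite entry time is attained.\<close>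

lemma entry_time_le_iff:
  assumes cont: "continuous_on {0..} (\<lambda>t. Z t \<omega>)" and t: "0 \<le> t"
  shows "entry_time Z l \<omega> \<le> ereal t \<longleftrightarrow> (\<exists>s\<in>{0..t}. Z s \<omega> = l \<omega>)"
proof
  assume le: "entry_time Z l \<omega> \<le> ereal t"
  define S where "S = {s\<in>{0..}. Z s \<omega> = l \<omega>}"
  \<comment> \<open>The infimum is taken back to a set of reals, where a nonempty closed set bounded
    below contains its infimum.\<close>
  have entry: "entry_time Z l \<omega> = Inf (ereal ` S)"
    unfolding entry_time_def S_def by (rule arg_cong[where f = Inf]) auto
  have "S \<noteq> {}"
    using le by (auto simp: entry top_ereal_def)
  moreover have bdd: "bdd_below S"
    by (auto simp: S_def intro!: bdd_belowI[of _ 0])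
  moreover have "closed S"
    unfolding S_def by (intro continuous_closed_preimage_constant cont closed_atLeast)
  ultimately have mem: "Inf S \<in> S"
    by (rule closed_contains_Inf)
  have "ereal (Inf S) \<le> Inf (ereal ` S)"
    using bdd by (auto intro!: INF_greatest cInf_lower)
  with le have "Inf S \<le> t"
    unfolding entry by (metis ereal_less_eq(3) order_trans)
  with mem show "\<exists>s\<in>{0..t}. Z s \<omega> = l \<omega>"
    by (auto simp: S_def)
next
  assume "\<exists>s\<in>{0..t}. Z s \<omega> = l \<omega>"
  then obtain s where s: "0 \<le> s" "s \<le> t" "Z s \<omega> = l \<omega>" by auto
  then have "entry_time Z l \<omega> \<le> ereal s"
    unfolding entry_time_def by (intro Inf_lower) auto
  with s show "entry_time Z l \<omega> \<le> ereal t"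
    by (meson ereal_less_eq(3) order_trans)
qed

text \<open>A continuous image of a compact interval is a compact interval, so every level between
  the two extrema is hit. The bounds make the conditionally complete \<open>INF\<close> and
  \<open>SUP\<close> on the reals meaningful.\<close>

lemma
  assumes cont: "continuous_on {0..} (\<lambda>t. Z t \<omega>)" and t: "0 \<le> t"
  shows bdd_below_path: "bdd_below ((\<lambda>s. Z s \<omega>) ` {0..t})"
    and bdd_above_path: "bdd_above ((\<lambda>s. Z s \<omega>) ` {0..t})"
    and path_image_eq_run_inf_sup: "(\<lambda>s. Z s \<omega>) ` {0..t} = {run_inf Z t \<omega>..run_sup Z t \<omega>}"
proof -
  have cont': "continuous_on {0..t} (\<lambda>t. Z t \<omega>)"
    using cont by (rule continuous_on_subset) auto
  from continuous_image_closed_interval[OF t cont']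
  obtain c d where cd: "(\<lambda>s. Z s \<omega>) ` {0..t} = {c..d}" "c \<le> d" by auto
  then show "bdd_below ((\<lambda>s. Z s \<omega>) ` {0..t})" "bdd_above ((\<lambda>s. Z s \<omega>) ` {0..t})"
    by auto
  show "(\<lambda>s. Z s \<omega>) ` {0..t} = {run_inf Z t \<omega>..run_sup Z t \<omega>}"
    unfolding run_inf_def run_sup_def cd using cd(2) by simp
qed

lemma run_inf_le_run_sup:
  assumes "continuous_on {0..} (\<lambda>t. Z t \<omega>)" and "0 \<le> t"
  shows "run_inf Z t \<omega> \<le> run_sup Z t \<omega>"
proof -
  have "{run_inf Z t \<omega>..run_sup Z t \<omega>} \<noteq> {}"
    using path_image_eq_run_inf_sup[of Z \<omega>, OF assms] assms(2) by (metis image_is_empty atLeastatMost_empty_iff2)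
  then show ?thesis by simp
qed

text \<open>Along a fixed path, hitting by time \<open>t\<close> becomes membership of the level in
  a closed interval, an event whose probability a distribution function expresses.\<close>

lemma entry_time_le_iff_between:
  assumes "continuous_on {0..} (\<lambda>t. Z t \<omega>)" and "0 \<le> t"
  shows "entry_time Z l \<omega> \<le> ereal t \<longleftrightarrow> l \<omega> \<in> {run_inf Z t \<omega>..run_sup Z t \<omega>}"
  unfolding entry_time_le_iff[of Z \<omega>, OF assms] path_image_eq_run_inf_sup[of Z \<omega>, OF assms, symmetric] by (metis image_iff)

text \<open>By continuity of the paths, the extrema over the uncountable set \<open>{0..t}\<close>
  are controlled by a countable dense subset.\<close>

lemma
  assumes meas: "\<And>s. 0 \<le> s \<Longrightarrow> Z s \<in> borel_measurable N"
    and cont: "\<And>\<omega>. \<omega> \<in> space N \<Longrightarrow> continuous_on {0..} (\<lambda>t. Z t \<omega>)"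
    and t: "0 \<le> t"
  shows borel_measurable_run_inf: "run_inf Z t \<in> borel_measurable N"
    and borel_measurable_run_sup: "run_sup Z t \<in> borel_measurable N"
proof -
  obtain D where D: "countable D" "D \<subseteq> {0..t}" "{0..t} \<subseteq> closure D"
    by (rule separable)
  have clD: "closure D = {0..t}"
    using D closure_minimal[of D "{0..t}"] by auto
  have contD: "continuous_on (closure D) (\<lambda>s. Z s \<omega>)" if "\<omega> \<in> space N" for \<omega>
    unfolding clD using cont[OF that] by (rule continuous_on_subset) auto
  have ne: "{0..t} \<noteq> {}" using t by simp
  note [measurable] = D(1)
  have [measurable]: "Z s \<in> borel_measurable N" if "s \<in> D" for s
    using that D meas by auto
  \<comment> \<open>A bound that holds on \<open>D\<close> passes to its closure
    \<open>{0..t}\<close>.\<close>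
  have "y \<le> run_inf Z t \<omega> \<longleftrightarrow> (\<forall>s\<in>D. y \<le> Z s \<omega>)" if w: "\<omega> \<in> space N" for y \<omega>
    unfolding run_inf_def le_cINF_iff[OF ne bdd_below_path[of Z \<omega>, OF cont[OF w] t]]
    using D continuous_ge_on_closure[OF contD[OF w]] by (auto simp: clD)
  moreover have "{\<omega> \<in> space N. \<forall>s\<in>D. y \<le> Z s \<omega>} \<in> sets N" for y
    by measurable
  ultimately show "run_inf Z t \<in> borel_measurable N"
    unfolding borel_measurable_iff_ge by (simp cong: conj_cong)
  have "run_sup Z t \<omega> \<le> y \<longleftrightarrow> (\<forall>s\<in>D. Z s \<omega> \<le> y)" if w: "\<omega> \<in> space N" for y \<omega>
    unfolding run_sup_def cSUP_le_iff[OF ne bdd_above_path[of Z \<omega>, OF cont[OF w] t]]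
    using D continuous_le_on_closure[OF contD[OF w]] by (auto simp: clD)
  moreover have "{\<omega> \<in> space N. \<forall>s\<in>D. Z s \<omega> \<le> y} \<in> sets N" for y
    by measurable
  ultimately show "run_sup Z t \<in> borel_measurable N"
    unfolding borel_measurable_iff_le by (simp cong: conj_cong)
qed

text \<open>Joint measurability in sample point and level is what Tonelli and the substitution of
  the random level require. With \<open>N\<close> arbitrary, the lemma serves both the sigma-algebra
  generated by \<open>Z\<close> and a single fixed path.\<close>

lemma borel_measurable_entry_time:
  assumes meas: "\<And>s. 0 \<le> s \<Longrightarrow> Z s \<in> borel_measurable N"
    and cont: "\<And>\<omega>. \<omega> \<in> space N \<Longrightarrow> continuous_on {0..} (\<lambda>t. Z t \<omega>)"
  shows "(\<lambda>(\<omega>, x). entry_time Z (\<lambda>_. x) \<omega>) \<in> borel_measurable (N \<Otimes>\<^sub>M borel)"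
  unfolding borel_measurable_iff_Iic_ereal
proof
  fix a :: ereal
  let ?T = "\<lambda>(\<omega>, x). entry_time Z (\<lambda>_. x) \<omega>" and ?P = "N \<Otimes>\<^sub>M (borel :: real measure)"
  \<comment> \<open>Entry times are nonnegative, so a negative \<open>a\<close> gives the empty set
    and \<open>\<infinity>\<close> the whole space; the running extrema enter only for finite
    \<open>a \<ge> 0\<close>.\<close>
  consider (neg) "a < 0" | (infty) "a = \<infinity>" | (nonneg) t where "a = ereal t" "0 \<le> t"
    by (cases a; cases "0 \<le> a") (auto simp: not_le)
  then show "?T -` {..a} \<inter> space ?P \<in> sets ?P"
  proof cases
    case neg
    then have "a < ?T p" for p
      by (cases p) (auto intro: less_le_trans entry_time_nonneg)
    then have "?T -` {..a} \<inter> space ?P = {}"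
      by (auto simp: not_le[symmetric])
    then show ?thesis by simp
  next
    case infty
    then have "?T -` {..a} \<inter> space ?P = space ?P" by auto
    then show ?thesis by simp
  next
    case nonneg
    note [measurable] = borel_measurable_run_inf[OF meas cont nonneg(2)]
      borel_measurable_run_sup[OF meas cont nonneg(2)]
    have "?T -` {..a} \<inter> space ?P =
        {p \<in> space ?P. run_inf Z t (fst p) \<le> snd p \<and> snd p \<le> run_sup Z t (fst p)}"
      using nonneg cont
      by (auto simp: space_pair_measure entry_time_le_iff_between)
    also have "\<dots> \<in> sets ?P" by measurable
    finally show ?thesis .
  qed
qed

section \<open>The delay as a time integral, and expectations with infinite values\<close>

text \<open>The positive part of \<open>r - T\<close> is the length of the interval from
  \<open>T\<close> to \<open>r\<close>. The product of indicators is ready for exchanging the time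
  integral with the integral over the level.\<close>

lemma delay_eq_nn_integral:
  assumes "0 \<le> T"
  shows "e2ennreal (max 0 (max (ereal r - T) 0)) =
    (\<integral>\<^sup>+t. indicator {0..r} t * indicator {t. T \<le> ereal t} t \<partial>lborel)"
proof -
  \<comment> \<open>The default \<open>{}\<close> is meant for \<open>T = \<infinity>\<close>; the
    value \<open>-\<infinity>\<close> is excluded by \<open>0 \<le> T\<close>.\<close>
  have "{t. T \<le> ereal t} = (case T of ereal s \<Rightarrow> {s..} | _ \<Rightarrow> {})"
    using assms by (cases T) auto
  then have "{t. T \<le> ereal t} \<in> sets borel"
    by (simp split: ereal.split)
  then have "(\<integral>\<^sup>+t. indicator {0..r} t * indicator {t. T \<le> ereal t} t \<partial>lborel) =
      emeasure lborel ({0..r} \<inter> {t. T \<le> ereal t})"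
    unfolding indicator_inter_arith[symmetric] by (subst nn_integral_indicator) simp_all
  also have "\<dots> = e2ennreal (max 0 (max (ereal r - T) 0))"
  proof (cases T)
    case (real s)
    then have "{0..r} \<inter> {t. T \<le> ereal t} = {s..r}" using assms by auto
    then show ?thesis using real
      by (cases "s \<le> r") (simp_all add: max_absorb1 max_absorb2 e2ennreal_neg)
  next
    case PInf
    then show ?thesis by (simp add: e2ennreal_neg)
  next
    case MInf
    then show ?thesis using assms by simp
  qed
  finally show ?thesis by simp
qed

lemma ext_expectation_nonneg:
  assumes "\<And>\<omega>. \<omega> \<in> space M \<Longrightarrow> 0 \<le> X \<omega>"
  shows "ext_expectation M X = enn2ereal (\<integral>\<^sup>+\<omega>. e2ennreal (X \<omega>) \<partial>M)"
proof -
  have "(\<integral>\<^sup>+\<omega>. e2ennreal (max 0 (- X \<omega>)) \<partial>M) = (\<integral>\<^sup>+\<omega>. 0 \<partial>M)"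
    using assms by (intro nn_integral_cong) (simp add: max_absorb1 e2ennreal_neg)
  moreover have "(\<integral>\<^sup>+\<omega>. e2ennreal (max 0 (X \<omega>)) \<partial>M) = (\<integral>\<^sup>+\<omega>. e2ennreal (X \<omega>) \<partial>M)"
    using assms by (intro nn_integral_cong) (auto simp: max_def)
  ultimately show ?thesis by (simp add: ext_expectation_def zero_ennreal.rep_eq)
qed

text \<open>\<open>D\<close> may have infinite expectation; the negative part of the difference then
  has one too, and both sides are \<open>-\<infinity>\<close>. Finiteness for \<open>U\<close> rules
  out infinity minus infinity.\<close>

lemma ext_expectation_diff:
  assumes U[measurable]: "U \<in> borel_measurable M" and D[measurable]: "D \<in> borel_measurable M"
    and nonneg: "\<And>\<omega>. \<omega> \<in> space M \<Longrightarrow> 0 \<le> U \<omega>" "\<And>\<omega>. \<omega> \<in> space M \<Longrightarrow> 0 \<le> D \<omega>"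
    and fin: "(\<integral>\<^sup>+\<omega>. ennreal (U \<omega>) \<partial>M) < \<infinity>"
  shows "ext_expectation M (\<lambda>\<omega>. ereal (U \<omega> - D \<omega>)) =
    enn2ereal (\<integral>\<^sup>+\<omega>. ennreal (U \<omega>) \<partial>M) - enn2ereal (\<integral>\<^sup>+\<omega>. ennreal (D \<omega>) \<partial>M)"
proof -
  let ?u = "\<integral>\<^sup>+\<omega>. ennreal (U \<omega>) \<partial>M" and ?d = "\<integral>\<^sup>+\<omega>. ennreal (D \<omega>) \<partial>M"
  let ?p = "\<integral>\<^sup>+\<omega>. ennreal (max 0 (U \<omega> - D \<omega>)) \<partial>M"
    and ?n = "\<integral>\<^sup>+\<omega>. ennreal (max 0 (D \<omega> - U \<omega>)) \<partial>M"
  \<comment> \<open>Pointwise both sums equal the maximum of \<open>U\<close> and \<open>D\<close>.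
    Working with sums avoids subtracting possibly infinite integrals.\<close>
  have "?p + ?d = ?n + ?u"
  proof -
    have "?p + ?d = (\<integral>\<^sup>+\<omega>. ennreal (max 0 (U \<omega> - D \<omega>)) + ennreal (D \<omega>) \<partial>M)"
      by (rule nn_integral_add[symmetric]) measurable
    also have "\<dots> = (\<integral>\<^sup>+\<omega>. ennreal (max 0 (D \<omega> - U \<omega>)) + ennreal (U \<omega>) \<partial>M)"
      using nonneg by (intro nn_integral_cong) (auto simp: ennreal_plus[symmetric] max_def simp del: ennreal_plus)
    also have "\<dots> = ?n + ?u"
      by (rule nn_integral_add) measurable
    finally show ?thesis .
  qed
  moreover have "?p \<le> ?u"
    using nonneg by (intro nn_integral_mono ennreal_leI) auto
  moreover have "e2ennreal (max 0 (ereal x)) = ennreal (max 0 x)" for x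
    using e2ennreal_ereal[of "max 0 x"] by (simp add: zero_ereal_def del: e2ennreal_ereal)
  then have "ext_expectation M (\<lambda>\<omega>. ereal (U \<omega> - D \<omega>)) = enn2ereal ?p - enn2ereal ?n"
    by (simp add: ext_expectation_def)
  ultimately show ?thesis
    using fin
    by (cases ?p; cases ?d; cases ?n; cases ?u)
       (auto simp: ennreal_plus[symmetric] top_unique enn2ereal_ennreal simp del: ennreal_plus)
qed

section \<open>Averaging over the level along a fixed path\<close>

context real_distribution
begin

text \<open>The left limit at \<open>x\<close> is the mass strictly below \<open>x\<close>, so the
  difference keeps a possible atom at \<open>x\<close>, as the closed interval does.\<close>

lemma cdf_diff_left_limit:
  assumes "x \<le> y"
  shows "cdf M y - left_limit (cdf M) x = measure M {x..y}"
proof -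
  have "left_limit (cdf M) x = measure M {..<x}"
    unfolding left_limit_def by (rule tendsto_Lim) (simp_all add: cdf_at_left)
  moreover have "measure M {..y} = measure M {..<x} + measure M {x..y}"
    using assms by (subst finite_measure_Union[symmetric]) (auto intro!: arg_cong[where f = "measure M"])
  ultimately show ?thesis by (simp add: cdf_def)
qed

lemma measure_entry_time_le:
  assumes "continuous_on {0..} (\<lambda>t. Z t \<omega>)" and "0 \<le> t"
  shows "measure M {x. entry_time Z (\<lambda>_. x) \<omega> \<le> ereal t} =
    cdf M (run_sup Z t \<omega>) - left_limit (cdf M) (run_inf Z t \<omega>)"
  unfolding cdf_diff_left_limit[OF run_inf_le_run_sup[of Z \<omega>, OF assms]] entry_time_le_iff_between[of Z \<omega>, OF assms]
  by (rule arg_cong[where f = "measure M"]) auto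

text \<open>Tonelli, applied to the indicator form of the delay, turns the mean delay along a fixed
  path into the time integral of the hitting probabilities.\<close>

lemma nn_integral_delay:
  assumes cont: "continuous_on {0..} (\<lambda>t. Z t \<omega>)" and r: "0 \<le> r"
  shows "(\<integral>\<^sup>+x. e2ennreal (max 0 (max (ereal r - entry_time Z (\<lambda>_. x) \<omega>) 0)) \<partial>M) =
    ennreal (LINT t:{0..r}|lborel. cdf M (run_sup Z t \<omega>) - left_limit (cdf M) (run_inf Z t \<omega>))"
proof -
  let ?T = "\<lambda>x. entry_time Z (\<lambda>_. x) \<omega>"
  \<comment> \<open>Joint measurability over a one-point space gives measurability in the level along a fixed path.\<close>
  have "(\<lambda>(\<omega>', x). entry_time (\<lambda>t _. Z t \<omega>) (\<lambda>_. x) \<omega>') \<in>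
      borel_measurable (count_space UNIV \<Otimes>\<^sub>M borel)"
    using cont by (intro borel_measurable_entry_time) auto
  from measurable_compose[OF measurable_Pair1'[of "()"] this]
  have T[measurable]: "?T \<in> borel_measurable borel"
    by (simp add: entry_time_def)
  interpret lborel: pair_sigma_finite lborel M ..
  \<comment> \<open>Defined through the entry time, \<open>H\<close> is measurable in
    \<open>t\<close> because \<open>?T\<close> is measurable. It agrees with the expression in
    \<open>cdf M\<close> at every \<open>t \<ge> 0\<close>, hence on the range of
    integration.\<close>
  define H where "H t = measure M {x. ?T x \<le> ereal t}" for t
  have H[measurable]: "H \<in> borel_measurable borel"
    unfolding H_def by measurable
  have "(\<integral>\<^sup>+x. e2ennreal (max 0 (max (ereal r - ?T x) 0)) \<partial>M) =
      (\<integral>\<^sup>+x. \<integral>\<^sup>+t. indicator {0..r} t * indicator {t. ?T x \<le> ereal t} t \<partial>lborel \<partial>M)"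
    by (simp only: delay_eq_nn_integral[OF entry_time_nonneg])
  also have "\<dots> = (\<integral>\<^sup>+t. \<integral>\<^sup>+x. indicator {0..r} t * indicator {x. ?T x \<le> ereal t} x \<partial>M \<partial>lborel)"
    by (subst lborel.Fubini') (auto simp: indicator_def)
  also have "\<dots> = (\<integral>\<^sup>+t. ennreal (indicator {0..r} t * H t) \<partial>lborel)"
    by (intro nn_integral_cong)
       (simp add: nn_integral_cmult emeasure_eq_measure H_def ennreal_mult ennreal_indicator)
  also have "\<dots> = ennreal (LINT t:{0..r}|lborel. H t)"
    unfolding set_lebesgue_integral_def real_scaleR_def
  proof (rule nn_integral_eq_integral)
    \<comment> \<open>As a probability \<open>H\<close> is at most 1, hence integrable over a
      bounded interval, so the Bochner integral is not the default value 0.\<close>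
    have "integrable lborel (indicator {0..r} :: real \<Rightarrow> real)"
      by (rule integrable_real_indicator) (cases "0 \<le> r"; simp)+
    then show "integrable lborel (\<lambda>t. indicator {0..r} t * H t)"
      by (rule Bochner_Integration.integrable_bound) (auto simp: H_def indicator_def)
  qed (auto simp: H_def)
  also have "(LINT t:{0..r}|lborel. H t) =
      (LINT t:{0..r}|lborel. cdf M (run_sup Z t \<omega>) - left_limit (cdf M) (run_inf Z t \<omega>))"
    by (rule set_lebesgue_integral_cong) (auto simp: H_def measure_entry_time_le[of Z \<omega>, OF cont])
  finally show ?thesis .
qed

end

section \<open>The sigma-algebra of the path and independence of the level\<close>

lemma space_gen_sigma: "space (gen_sigma M X I) = space M"
  unfolding gen_sigma_def by (rule space_measure_of) auto

lemma sets_gen_sigma: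
  "sets (gen_sigma M X I) =
    sigma_sets (space M) {X s -` A \<inter> space M | s A. s \<in> I \<and> A \<in> sets borel}"
  unfolding gen_sigma_def by (rule sets_measure_of) auto

lemma sets_gen_sigma_mono: "I \<subseteq> J \<Longrightarrow> sets (gen_sigma M X I) \<subseteq> sets (gen_sigma M X J)"
  unfolding sets_gen_sigma by (rule sigma_sets_mono') auto

lemma borel_measurable_gen_sigma: "s \<in> I \<Longrightarrow> X s \<in> borel_measurable (gen_sigma M X I)"
  by (rule measurableI) (auto simp: space_gen_sigma sets_gen_sigma)

text \<open>This makes \<open>\<tau>\<close> a functional of the whole path, so that independence of
  the level from the path covers \<open>\<tau>\<close> as well.\<close>

lemma borel_measurable_stopping_times_of:
  assumes "\<tau> \<in> stopping_times_of M X"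
  shows "\<tau> \<in> borel_measurable (gen_sigma M X {0..})"
  using assms unfolding stopping_times_of_def natural_filtration_def
  by (intro measurable_stopping_time[where F = "\<lambda>t. gen_sigma M X {0..t}"] sets_gen_sigma_mono)
     (auto simp: space_gen_sigma)

text \<open>By independence, the pair of the sample point, seen through \<open>N\<close>, and
  \<open>l\<close> has a product law. Hence \<open>l\<close> may be averaged out first, with the
  sample point frozen.\<close>

lemma (in prob_space) nn_integral_indep_sigma:
  assumes l: "l \<in> M \<rightarrow>\<^sub>M S"
    and N: "space N = space M"
    and indep: "indep_set (sets (vimage_algebra (space M) l S)) (sets N)"
    and f: "f \<in> borel_measurable (N \<Otimes>\<^sub>M S)"
  shows "(\<integral>\<^sup>+\<omega>. f (\<omega>, l \<omega>) \<partial>M) = (\<integral>\<^sup>+\<omega>. \<integral>\<^sup>+x. f (\<omega>, x) \<partial>distr M S l \<partial>M)"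
proof -
  have sub: "sets N \<subseteq> sets M"
    using indep by (auto simp: indep_set_def indep_sets_def split: bool.splits)
  then have id: "(\<lambda>\<omega>. \<omega>) \<in> M \<rightarrow>\<^sub>M N"
    using N by (auto intro!: measurableI dest: sets.sets_into_space)
  interpret L: prob_space "distr M S l" by (rule prob_space_distr[OF l])
  interpret N: prob_space "distr M N (\<lambda>\<omega>. \<omega>)" by (rule prob_space_distr[OF id])
  have pair[measurable]: "(\<lambda>\<omega>. (\<omega>, l \<omega>)) \<in> M \<rightarrow>\<^sub>M N \<Otimes>\<^sub>M S"
    using id l by (rule measurable_Pair)
  \<comment> \<open>A product of sigma-finite measures is determined by rectangles, and there
    independence gives the factorization.\<close>
  have distr: "distr M N (\<lambda>\<omega>. \<omega>) \<Otimes>\<^sub>M distr M S l = distr M (N \<Otimes>\<^sub>M S) (\<lambda>\<omega>. (\<omega>, l \<omega>))"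
  proof (rule pair_measure_eqI)
    fix A B
    assume "A \<in> sets (distr M N (\<lambda>\<omega>. \<omega>))" and "B \<in> sets (distr M S l)"
    then have A: "A \<in> sets N" and B: "B \<in> sets S" by simp_all
    have "A \<subseteq> space M" using sets.sets_into_space[OF A] N by simp
    then have A_eq: "A \<inter> space M = A" by auto
    have "(\<lambda>\<omega>. (\<omega>, l \<omega>)) -` (A \<times> B) \<inter> space M = (l -` B \<inter> space M) \<inter> A"
      using \<open>A \<subseteq> space M\<close> by auto
    moreover have "prob ((l -` B \<inter> space M) \<inter> A) = prob (l -` B \<inter> space M) * prob A"
      by (rule indep_setD[OF indep in_vimage_algebra[OF B] A])
    ultimately show "emeasure (distr M N (\<lambda>\<omega>. \<omega>)) A * emeasure (distr M S l) B =
        emeasure (distr M (N \<Otimes>\<^sub>M S) (\<lambda>\<omega>. (\<omega>, l \<omega>))) (A \<times> B)"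
      using A B by (simp add: emeasure_distr id l pair A_eq emeasure_eq_measure ennreal_mult mult.commute)
  qed (auto intro: N.sigma_finite_measure_axioms L.sigma_finite_measure_axioms cong: sets_pair_measure_cong)
  have f': "f \<in> borel_measurable (N \<Otimes>\<^sub>M distr M S l)"
    using f by (simp cong: measurable_cong_sets)
  have "(\<integral>\<^sup>+\<omega>. f (\<omega>, l \<omega>) \<partial>M) = integral\<^sup>N (distr M (N \<Otimes>\<^sub>M S) (\<lambda>\<omega>. (\<omega>, l \<omega>))) f"
    by (rule nn_integral_distr[symmetric]) (use id l f in auto)
  also have "\<dots> = (\<integral>\<^sup>+\<omega>. \<integral>\<^sup>+x. f (\<omega>, x) \<partial>distr M S l \<partial>distr M N (\<lambda>\<omega>. \<omega>))"
    unfolding distr[symmetric]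
    by (rule L.nn_integral_fst[symmetric]) (use f' in \<open>simp cong: measurable_cong_sets\<close>)
  also have "\<dots> = (\<integral>\<^sup>+\<omega>. \<integral>\<^sup>+x. f (\<omega>, x) \<partial>distr M S l \<partial>M)"
    by (rule nn_integral_distr[OF id]) (use L.borel_measurable_nn_integral_fst[OF f'] in simp)
  finally show ?thesis .
qed

section \<open>The risk of a stopping time is one minus its gain\<close>

lemma (in prob_space) detection_risk_eq:
  fixes l :: "'a \<Rightarrow> real"
  assumes l[measurable]: "l \<in> borel_measurable M"
    and cont: "\<And>\<omega>. \<omega> \<in> space M \<Longrightarrow> continuous_on {0..} (\<lambda>t. Z t \<omega>)"
    and indep: "indep_set (sets (vimage_algebra (space M) l borel)) (sets (gen_sigma M Z {0..}))"
    and c: "0 \<le> c"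
    and \<tau>: "\<tau> \<in> stopping_times_of M Z"
  shows "detection_risk M Z l c \<tau> = 1 - stopping_gain M Z (cdf (distr M borel l)) c \<tau>"
proof -
  define N where "N = gen_sigma M Z {0..}"
  define F where "F = cdf (distr M borel l)"
  have space_N: "space N = space M" by (simp add: N_def space_gen_sigma)
  interpret L: real_distribution "distr M borel l"
    by (rule real_distribution_distr) fact
  have \<tau>_nonneg: "0 \<le> \<tau> \<omega>" if "\<omega> \<in> space M" for \<omega>
    using \<tau> that by (simp add: stopping_times_of_def)
  have \<tau>_meas[measurable]: "\<tau> \<in> borel_measurable N"
    unfolding N_def using \<tau> by (rule borel_measurable_stopping_times_of)
  have "sets N \<subseteq> sets M"
    using indep by (auto simp: N_def indep_set_def indep_sets_def split: bool.splits)
  then have measurable_N: "f \<in> borel_measurable M" if "f \<in> borel_measurable N" for f :: "'a \<Rightarrow> 'b :: topological_space"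
    using that space_N by (auto simp: measurable_def)
  note transfer = nn_integral_indep_sigma[OF l space_N indep[folded N_def]]
  define T where "T p = entry_time Z (\<lambda>_. snd p) (fst p)" for p
  have T[measurable]: "T \<in> borel_measurable (N \<Otimes>\<^sub>M borel)"
  proof -
    have "Z s \<in> borel_measurable N" if "0 \<le> s" for s
      using that by (simp add: N_def borel_measurable_gen_sigma)
    from borel_measurable_entry_time[of Z N, OF this cont] show ?thesis
      by (simp add: T_def[abs_def] split_beta' space_N)
  qed
  \<comment> \<open>The entry time at \<open>\<omega>\<close> depends on \<open>l\<close> only
    through the value \<open>l \<omega>\<close>, so the level may be frozen to a constant.\<close>
  have T_l: "entry_time Z l \<omega> = T (\<omega>, l \<omega>)" for \<omega>
    by (simp add: T_def entry_time_def)
  have id_l: "(\<lambda>\<omega>. (\<omega>, l \<omega>)) \<in> M \<rightarrow>\<^sub>M N \<Otimes>\<^sub>M borel"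
  proof (rule measurable_Pair[OF _ l])
    show "(\<lambda>\<omega>. \<omega>) \<in> M \<rightarrow>\<^sub>M N"
      using \<open>sets N \<subseteq> sets M\<close> space_N
      by (auto intro!: measurableI dest: sets.sets_into_space)
  qed

  \<comment> \<open>Given the path, \<open>U\<close> is the probability that the level has been hit
    by time \<open>\<tau>\<close>, and \<open>D\<close> is the mean delay.\<close>
  define U where "U \<omega> = F (run_sup Z (\<tau> \<omega>) \<omega>) - left_limit F (run_inf Z (\<tau> \<omega>) \<omega>)" for \<omega>
  define D where
    "D \<omega> = (LINT t:{0..\<tau> \<omega>}|lborel. F (run_sup Z t \<omega>) - left_limit F (run_inf Z t \<omega>))" for \<omega>

  let ?hit = "\<lambda>p. if T p \<le> ereal (\<tau> (fst p)) then 1 else 0 :: ennreal"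
  let ?delay = "\<lambda>p. e2ennreal (max 0 (max (ereal (\<tau> (fst p)) - T p) 0))"
  have hit_meas: "?hit \<in> borel_measurable (N \<Otimes>\<^sub>M borel)"
    by measurable
  have delay_meas: "?delay \<in> borel_measurable (N \<Otimes>\<^sub>M borel)"
    by measurable
  have U_eq: "ennreal (U \<omega>) = (\<integral>\<^sup>+x. ?hit (\<omega>, x) \<partial>distr M borel l)"
    and U_measure: "U \<omega> = measure (distr M borel l) {x. T (\<omega>, x) \<le> ereal (\<tau> \<omega>)}"
    if "\<omega> \<in> space M" for \<omega>
  proof -
    show *: "U \<omega> = measure (distr M borel l) {x. T (\<omega>, x) \<le> ereal (\<tau> \<omega>)}"
      using L.measure_entry_time_le[of Z \<omega>, OF cont[OF that] \<tau>_nonneg[OF that]] by (simp add: U_def F_def T_def)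
    have "{x. T (\<omega>, x) \<le> ereal (\<tau> \<omega>)} = {run_inf Z (\<tau> \<omega>) \<omega>..run_sup Z (\<tau> \<omega>) \<omega>}"
      using entry_time_le_iff_between[of Z \<omega>, OF cont[OF that] \<tau>_nonneg[OF that]] by (auto simp: T_def)
    then have "{x. T (\<omega>, x) \<le> ereal (\<tau> \<omega>)} \<in> sets (distr M borel l)" by simp
    then have "ennreal (U \<omega>) =
        (\<integral>\<^sup>+x. indicator {x. T (\<omega>, x) \<le> ereal (\<tau> \<omega>)} x \<partial>distr M borel l)"
      by (simp add: * L.emeasure_eq_measure)
    then show "ennreal (U \<omega>) = (\<integral>\<^sup>+x. ?hit (\<omega>, x) \<partial>distr M borel l)"
      by (simp add: indicator_def of_bool_def)
  qed
  have D_eq: "ennreal (D \<omega>) = (\<integral>\<^sup>+x. ?delay (\<omega>, x) \<partial>distr M borel l)"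
    if "\<omega> \<in> space M" for \<omega>
    using L.nn_integral_delay[of Z \<omega>, OF cont[OF that] \<tau>_nonneg[OF that]] by (simp add: D_def F_def T_def)
  have U_bounds: "0 \<le> U \<omega>" "U \<omega> \<le> 1" if "\<omega> \<in> space M" for \<omega>
    by (simp_all add: U_measure[OF that])
  have D_nonneg: "0 \<le> D \<omega>" if "\<omega> \<in> space M" for \<omega>
    unfolding D_def set_lebesgue_integral_def F_def
    using L.measure_entry_time_le[of Z \<omega>, OF cont[OF that], symmetric]
    by (intro Bochner_Integration.integral_nonneg) (auto simp: indicator_def)

  \<comment> \<open>A nonnegative real \<open>g\<close> is recovered by \<open>enn2real\<close> from
    an integral over the level, which is measurable in the sample point. This handles the random
    time \<open>\<tau>\<close> inside \<open>U\<close> and \<open>D\<close>.\<close>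
  have measurableI: "g \<in> borel_measurable M"
    if f: "f \<in> borel_measurable (N \<Otimes>\<^sub>M borel)"
      and g: "\<And>\<omega>. \<omega> \<in> space M \<Longrightarrow> ennreal (g \<omega>) = (\<integral>\<^sup>+x. f (\<omega>, x) \<partial>distr M borel l)"
      and nonneg: "\<And>\<omega>. \<omega> \<in> space M \<Longrightarrow> 0 \<le> g \<omega>" for f and g :: "'a \<Rightarrow> real"
  proof -
    have "(\<lambda>\<omega>. \<integral>\<^sup>+x. f (\<omega>, x) \<partial>distr M borel l) \<in> borel_measurable N"
      using f by (intro L.borel_measurable_nn_integral_fst) (simp cong: measurable_cong_sets)
    then have "(\<lambda>\<omega>. enn2real (\<integral>\<^sup>+x. f (\<omega>, x) \<partial>distr M borel l)) \<in> borel_measurable M"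
      by (intro measurable_N borel_measurable_enn2real)
    then show ?thesis
      by (rule measurable_cong[THEN iffD1, rotated]) (simp add: g[symmetric] nonneg)
  qed
  have U_meas: "U \<in> borel_measurable M"
    by (rule measurableI[OF hit_meas U_eq U_bounds(1)])
  have D_meas: "D \<in> borel_measurable M"
    by (rule measurableI[OF delay_meas D_eq D_nonneg])

  let ?A = "{\<omega> \<in> space M. entry_time Z l \<omega> \<le> ereal (\<tau> \<omega>)}"
  have A: "?A \<in> events"
    unfolding T_l using measurable_compose[OF id_l T] measurable_N[OF \<tau>_meas] by simp
  have "(\<integral>\<^sup>+\<omega>. ennreal (U \<omega>) \<partial>M) = (\<integral>\<^sup>+\<omega>. ?hit (\<omega>, l \<omega>) \<partial>M)"
    unfolding transfer[OF hit_meas] by (rule nn_integral_cong) (rule U_eq)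
  also have "\<dots> = (\<integral>\<^sup>+\<omega>. indicator ?A \<omega> \<partial>M)"
    by (rule nn_integral_cong) (simp add: T_l)
  also have "\<dots> = emeasure M ?A"
    using A by simp
  finally have U_int: "(\<integral>\<^sup>+\<omega>. ennreal (U \<omega>) \<partial>M) = ennreal (prob ?A)"
    by (simp add: emeasure_eq_measure)
  have D_int: "ext_expectation M (\<lambda>\<omega>. max (ereal (\<tau> \<omega>) - entry_time Z l \<omega>) 0) =
      enn2ereal (\<integral>\<^sup>+\<omega>. ennreal (D \<omega>) \<partial>M)"
  proof -
    have "(\<integral>\<^sup>+\<omega>. ennreal (D \<omega>) \<partial>M) = (\<integral>\<^sup>+\<omega>. ?delay (\<omega>, l \<omega>) \<partial>M)"
      unfolding transfer[OF delay_meas] by (rule nn_integral_cong) (rule D_eq)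
    also have "\<dots> = (\<integral>\<^sup>+\<omega>. e2ennreal (max (ereal (\<tau> \<omega>) - entry_time Z l \<omega>) 0) \<partial>M)"
      by (rule nn_integral_cong) (simp add: T_l)
    finally show ?thesis by (simp add: ext_expectation_nonneg)
  qed
  have "prob {\<omega> \<in> space M. ereal (\<tau> \<omega>) < entry_time Z l \<omega>} = 1 - prob ?A"
    using prob_neg[OF A] by (simp add: not_le)
  moreover have "stopping_gain M Z F c \<tau> =
      enn2ereal (\<integral>\<^sup>+\<omega>. ennreal (U \<omega>) \<partial>M) - enn2ereal (\<integral>\<^sup>+\<omega>. ennreal (c * D \<omega>) \<partial>M)"
    unfolding stopping_gain_def U_def[symmetric] D_def[symmetric]
    by (rule ext_expectation_diff)
       (use U_meas D_meas U_bounds D_nonneg c in \<open>simp_all add: U_int\<close>)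
  moreover have "enn2ereal (\<integral>\<^sup>+\<omega>. ennreal (c * D \<omega>) \<partial>M) =
      ereal c * enn2ereal (\<integral>\<^sup>+\<omega>. ennreal (D \<omega>) \<partial>M)"
    using c D_nonneg D_meas
    by (simp add: ennreal_mult nn_integral_cmult times_ennreal.rep_eq enn2ereal_ennreal cong: nn_integral_cong)
  \<comment> \<open>If the mean delay is infinite and \<open>c > 0\<close>, the risk is
    \<open>\<infinity>\<close> and the gain \<open>-\<infinity>\<close>; for \<open>c = 0\<close>
    the convention that zero times infinity is zero acts alike on both sides.\<close>
  ultimately show ?thesis
    unfolding detection_risk_def F_def[symmetric] D_int U_int
    using c by (cases "\<integral>\<^sup>+\<omega>. ennreal (D \<omega>) \<partial>M") (auto simp: enn2ereal_ennreal one_ereal_def)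
qed

section \<open>Equivalence of the two problems\<close>

theorem proposition1:
  fixes M :: "'w measure"
    and G :: "real \<Rightarrow> 'w measure"
    and a b :: "real \<Rightarrow> real"
    and B Z :: "real \<Rightarrow> 'w \<Rightarrow> real"
    and l :: "'w \<Rightarrow> real"
    and F :: "real \<Rightarrow> real"
    and c :: real
  assumes "prob_space M"
    and "filtration (space M) G"
    and "\<And>t. subalgebra M (G t)"
    and "continuous_on UNIV a"
    and "continuous_on UNIV b"
    and "\<And>x. b x > 0"
    and "local_lipschitz (UNIV :: real set) UNIV (\<lambda>_ x. (b x)\<^sup>2)"
    and "brownian_motion M G B"
    and "diffusion_solving M G a b B Z"
    and "AE \<omega> in M. Z 0 \<omega> = 0"
    and "l \<in> borel_measurable M"
    and "prob_space.indep_set M (sets (vimage_algebra (space M) l borel)) (sets (gen_sigma M Z {0..}))"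
    and "F = cdf (distr M borel l)"
    and "c > 0"
  shows "V1 M Z l c = 1 - V2 M Z F c \<and>
         (\<forall>\<tau>\<in>stopping_times_of M Z.
            detection_risk M Z l c \<tau> = V1 M Z l c \<longleftrightarrow> stopping_gain M Z F c \<tau> = V2 M Z F c)"
proof -
  interpret prob_space M by fact
  have cont: "continuous_on {0..} (\<lambda>t. Z t \<omega>)" if "\<omega> \<in> space M" for \<omega>
    using \<open>diffusion_solving M G a b B Z\<close> that by (simp add: diffusion_solving_def)
  have risk: "detection_risk M Z l c \<tau> = 1 - stopping_gain M Z F c \<tau>"
    if "\<tau> \<in> stopping_times_of M Z" for \<tau>
    unfolding \<open>F = cdf (distr M borel l)\<close>
    using assms cont that by (intro detection_risk_eq) auto
  \<comment> \<open>Stopping at once shows that the infimum runs over a nonempty set, which is used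
    to turn it into \<open>1\<close> minus a supremum.\<close>
  have "(\<lambda>_. 0) \<in> stopping_times_of M Z"
    by (simp add: stopping_times_of_def stopping_time_const)
  then have "stopping_times_of M Z \<noteq> {}" by blast
  then have V1: "V1 M Z l c = 1 - V2 M Z F c"
    unfolding V1_def V2_def
    by (subst INF_ereal_minus_right[symmetric]) (auto simp: risk intro!: INF_cong)
  \<comment> \<open>Since 1 is finite, subtraction from 1 is injective also at infinite values; this
    carries optimality over in both directions.\<close>
  have "(1 - x = 1 - y) = (x = y)" for x y :: ereal
    by (cases x; cases y) (auto simp: one_ereal_def)
  then show ?thesis by (simp add: V1 risk)
qed

end
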